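(* If $k$ is a positive integer and $n_1,\dots,n_k$ are integers with $n_i \geq 3$ for $1\leq i\leq k$, then $B(\boxtimes_{i=1}^k P_{n_i}) = 3^k - 1$.
   Context: $P_n$ is the path on $n$ vertices and $\boxtimes_{i=1}^k P_{n_i} = P_{n_1}\boxtimes\cdots\boxtimes P_{n_k}$, where the strong product $G\boxtimes H$ has vertex set $V(G)\times V(H)$, with distinct $(u,v)$ and $(x,y)$ adjacent iff either $ux \in E(G)$ and $v=y$, or $u=x$ and $vy\in E(H)$, or $ux \in E(G)$ and $vy\in E(H)$. Bodyguards and Presidents is a two-player game on a finite simple graph $G$. One player controls a set of tokens called bodyguards, the other a single token called the president. First all bodyguards are placed on vertices (several may share a vertex), then the president is placed. The players then alternate turns, bodyguards first; on a player's turn, each token they control either moves to an adjacent vertex or stays put. The president is surrounded if every vertex of the open neighbourhood of the president's vertex is occupied by a bodyguard. The bodyguards win if there is a finite time after which, at the end of every bodyguard turn, the president is surrounded; otherwise the president wins. The bodyguard number $B(G)$ is the minimum number of bodyguards that guarantees a win for the bodyguards on $G$. *)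

theory Defs
  imports "Graph_Theory.Pair_Digraph"
begin

text \<open>
  Finite simple graphs are the library's \<open>pair_graph\<close>s: an edge \<open>uv\<close> is the pair of arcs
  \<open>(u, v)\<close>, \<open>(v, u)\<close>.
\<close>

definition path_graph :: "nat \<Rightarrow> nat pair_pre_digraph" where
  "path_graph n = \<lparr> pverts = {..<n},
     parcs = {(i, j). i < n \<and> j < n \<and> (j = Suc i \<or> i = Suc j)} \<rparr>"

definition strong_product ::
    "'a pair_pre_digraph \<Rightarrow> 'b pair_pre_digraph \<Rightarrow> ('a \<times> 'b) pair_pre_digraph"
    (infixr "\<boxtimes>" 70) where
  "G \<boxtimes> H = \<lparr> pverts = pverts G \<times> pverts H,
     parcs = {((u, v), (x, y)).
       (u, v) \<in> pverts G \<times> pverts H \<and> (x, y) \<in> pverts G \<times> pverts H \<and> (u, v) \<noteq> (x, y) \<and>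
       ((u, x) \<in> parcs G \<and> v = y \<or>
        u = x \<and> (v, y) \<in> parcs H \<or>
        (u, x) \<in> parcs G \<and> (v, y) \<in> parcs H)} \<rparr>"

definition relabel :: "('a \<Rightarrow> 'b) \<Rightarrow> 'a pair_pre_digraph \<Rightarrow> 'b pair_pre_digraph" where
  "relabel f G = \<lparr> pverts = f ` pverts G, parcs = map_prod f f ` parcs G \<rparr>"

text \<open>
  The product of \<open>[G\<^sub>1, \<dots>, G\<^sub>k]\<close> is \<open>G\<^sub>1 \<boxtimes> (\<dots> \<boxtimes> (G\<^sub>k \<boxtimes> K\<^sub>1))\<close>, with the nested tuples
  \<open>(x\<^sub>1, (\<dots>, (x\<^sub>k, [])))\<close> renamed to the lists \<open>[x\<^sub>1, \<dots>, x\<^sub>k]\<close> so that all \<open>k\<close> share one type.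
  The one-vertex graph \<open>K\<^sub>1\<close> is neutral for the strong product up to isomorphism.
\<close>

primrec strong_product_list :: "'a pair_pre_digraph list \<Rightarrow> 'a list pair_pre_digraph" where
  "strong_product_list [] = \<lparr> pverts = {[]}, parcs = {} \<rparr>"
| "strong_product_list (G # Gs) = relabel (\<lambda>(x, xs). x # xs) (G \<boxtimes> strong_product_list Gs)"

definition token_step :: "'a pair_pre_digraph \<Rightarrow> 'a \<Rightarrow> 'a \<Rightarrow> bool" where
  "token_step G u v \<longleftrightarrow> v = u \<or> (u, v) \<in> parcs G"

text \<open>
  \<open>p t\<close> is the president's vertex after \<open>t\<close> president turns; \<open>p 0\<close> is the initial placement.
\<close>

definition president_play :: "'a pair_pre_digraph \<Rightarrow> (nat \<Rightarrow> 'a) \<Rightarrow> bool" where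
  "president_play G p \<longleftrightarrow> p 0 \<in> pverts G \<and> (\<forall>t. token_step G (p t) (p (Suc t)))"

text \<open>
  A strategy \<open>S\<close> for \<open>m\<close> bodyguards maps the list of president positions seen so far to the
  positions of the bodyguards \<open>0, \<dots>, m - 1\<close>: \<open>S []\<close> is the placement, made before the president
  is placed, and \<open>S [p\<^sub>0, \<dots>, p\<^sub>t]\<close> is the configuration after bodyguard turn number \<open>t + 1\<close>,
  which answers the president being on \<open>p\<^sub>t\<close>. The bodyguards' own past moves are determined by
  \<open>S\<close> and the president's moves, so this allows dependence on the whole history of the game.
\<close>

definition bodyguard_strategy ::
    "'a pair_pre_digraph \<Rightarrow> nat \<Rightarrow> ('a list \<Rightarrow> nat \<Rightarrow> 'a) \<Rightarrow> bool" where
  "bodyguard_strategy G m S \<longleftrightarrow>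
     (\<forall>i<m. S [] i \<in> pverts G) \<and>
     (\<forall>p. president_play G p \<longrightarrow>
        (\<forall>t. \<forall>i<m. token_step G (S (map p [0..<t]) i) (S (map p [0..<Suc t]) i)))"

definition surrounded :: "'a pair_pre_digraph \<Rightarrow> nat \<Rightarrow> (nat \<Rightarrow> 'a) \<Rightarrow> 'a \<Rightarrow> bool" where
  "surrounded G m c v \<longleftrightarrow> (\<forall>w. (v, w) \<in> parcs G \<longrightarrow> (\<exists>i<m. c i = w))"

definition bodyguards_win :: "'a pair_pre_digraph \<Rightarrow> nat \<Rightarrow> bool" where
  "bodyguards_win G m \<longleftrightarrow>
     (\<exists>S. bodyguard_strategy G m S \<and>
        (\<forall>p. president_play G p \<longrightarrow>
           (\<exists>T. \<forall>t\<ge>T. surrounded G m (S (map p [0..<Suc t])) (p t))))"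

definition bodyguard_number :: "'a pair_pre_digraph \<Rightarrow> nat" where
  "bodyguard_number G = (LEAST m. bodyguards_win G m)"

text \<open>
  On a finite graph, one stationary bodyguard per vertex wins, so the minimum exists.
\<close>

lemma bodyguards_win_card:
  assumes "pair_graph G"
  shows "bodyguards_win G (card (pverts G))"
proof -
  interpret pair_graph G by fact
  obtain c where c: "bij_betw c {0..<card (pverts G)} (pverts G)"
    using ex_bij_betw_nat_finite pair_finite_verts by blast
  have 1: "bodyguard_strategy G (card (pverts G)) (\<lambda>_. c)"
    using c by (auto simp: bodyguard_strategy_def token_step_def bij_betw_def)
  have 2: "surrounded G (card (pverts G)) c v" for v
    unfolding surrounded_def
  proof (intro allI impI)
    fix w assume "(v, w) \<in> parcs G"
    hence "w \<in> c ` {0..<card (pverts G)}"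
      using c in_arcsD2 by (auto simp: bij_betw_def)
    thus "\<exists>i<card (pverts G). c i = w" by auto
  qed
  show ?thesis
    unfolding bodyguards_win_def using 1 2 by blast
qed

lemma pair_graphI:
  assumes "finite (pverts G)" "parcs G \<subseteq> pverts G \<times> pverts G" "irrefl (parcs G)" "sym (parcs G)"
  shows "pair_graph G"
proof unfold_locales
  show "finite (parcs G)"
    using assms(1,2) finite_subset by blast
  show "symmetric (with_proj G)"
    using assms(4) by (simp add: symmetric_def)
qed (use assms in \<open>auto simp: irrefl_def\<close>)

lemma pair_graph_irrefl_sym:
  assumes "pair_graph G"
  shows "irrefl (parcs G)" "sym (parcs G)"
proof -
  interpret pair_graph G by fact
  show "irrefl (parcs G)" using pair_no_loops by (force simp: irrefl_def)
  show "sym (parcs G)" using pair_sym_arcs by (simp add: symmetric_def)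
qed

lemma pair_graph_path_graph: "pair_graph (path_graph n)"
  by (rule pair_graphI) (auto simp: path_graph_def irrefl_def sym_def)

lemma pair_graph_strong_product:
  assumes "pair_graph G" "pair_graph H"
  shows "pair_graph (G \<boxtimes> H)"
proof (rule pair_graphI)
  show "finite (pverts (G \<boxtimes> H))"
    using assms by (simp add: strong_product_def pair_fin_digraph.pair_finite_verts
        pair_graph.axioms pair_digraph.axioms)
  show "sym (parcs (G \<boxtimes> H))"
    using pair_graph_irrefl_sym(2)[OF assms(1)] pair_graph_irrefl_sym(2)[OF assms(2)]
    by (auto simp: strong_product_def sym_def)
qed (auto simp: strong_product_def irrefl_def)

lemma pair_graph_relabel:
  assumes "pair_graph G" "inj f"
  shows "pair_graph (relabel f G)"
proof (rule pair_graphI)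
  interpret pair_graph G by fact
  show "finite (pverts (relabel f G))"
    using pair_finite_verts by (simp add: relabel_def)
  show "parcs (relabel f G) \<subseteq> pverts (relabel f G) \<times> pverts (relabel f G)"
    using in_arcsD1 in_arcsD2 by (auto simp: relabel_def)
  show "irrefl (parcs (relabel f G))"
    using pair_graph_irrefl_sym(1)[OF assms(1)] assms(2)
    by (auto simp: relabel_def irrefl_def inj_eq)
  show "sym (parcs (relabel f G))"
    using pair_graph_irrefl_sym(2)[OF assms(1)] by (force simp: relabel_def sym_def)
qed

lemma pair_graph_strong_product_list:
  assumes "\<And>G. G \<in> set Gs \<Longrightarrow> pair_graph G"
  shows "pair_graph (strong_product_list Gs)"
  using assms
proof (induction Gs)
  case Nil
  show ?case by (rule pair_graphI) (auto simp: irrefl_def sym_def)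
next
  case (Cons G Gs)
  have "inj (\<lambda>(x, xs). x # xs)" by (auto simp: inj_def)
  then show ?case
    using Cons by (auto intro!: pair_graph_relabel pair_graph_strong_product)
qed

end

theory Submission
  imports Defs
begin

text \<open>
  In the grid, vertices are adjacent iff they are distinct and differ by at most one in every
  coordinate. A president resting on \<open>(1, \<dots>, 1)\<close> has \<open>3\<^sup>k - 1\<close> neighbours, which all have to be
  occupied. Conversely, assign one bodyguard to each nonzero offset \<open>d \<in> {-1, 0, 1}\<^sup>k\<close>. Clamping
  the \<open>i\<close>-th coordinate of \<open>p + d\<close> to the path \<open>P\<^sub>n\<^sub>i\<close> gives a target that moves by at most one
  per coordinate when the president moves. After \<open>t\<close> turns the bodyguard stands, in every
  coordinate, on the minimum of \<open>t\<close> and the target; this is a legal way to move, and once \<open>t\<close>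
  exceeds all path lengths every bodyguard is on its target for ever.
\<close>

text \<open>Distance at most one, without truncated subtraction. It is reflexive, so it also covers
  a token that stays put.\<close>

definition near :: "nat \<Rightarrow> nat \<Rightarrow> bool" where
  "near x y \<longleftrightarrow> x \<le> Suc y \<and> y \<le> Suc x"

abbreviation grid :: "nat list \<Rightarrow> nat list pair_pre_digraph" where
  "grid ns \<equiv> strong_product_list (map path_graph ns)"

lemma pverts_grid: "pverts (grid ns) = {xs. list_all2 (<) xs ns}"
proof (induction ns)
  case (Cons n ns)
  then show ?case
    by (auto simp: relabel_def strong_product_def path_graph_def list_all2_Cons2 image_iff)
qed auto

lemma parcs_strong_product_list_Cons:
  "(xs, ys) \<in> parcs (strong_product_list (G # Gs)) \<longleftrightarrow>
     (\<exists>x xs' y ys'. xs = x # xs' \<and> ys = y # ys' \<and>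
        ((x, xs'), (y, ys')) \<in> parcs (G \<boxtimes> strong_product_list Gs))"
  by (force simp: relabel_def)

text \<open>The three kinds of arcs of a strong product merge into "equal or adjacent in each
  factor, but not equal in both"; on a path, equal or adjacent means \<open>near\<close>.\<close>

lemma parcs_grid:
  "(xs, ys) \<in> parcs (grid ns) \<longleftrightarrow>
     xs \<noteq> ys \<and> xs \<in> pverts (grid ns) \<and> ys \<in> pverts (grid ns) \<and> list_all2 near xs ys"
proof (induction ns arbitrary: xs ys)
  case Nil
  then show ?case by auto
next
  case (Cons n ns)
  have refl: "list_all2 near zs zs" for zs
    by (simp add: list_all2_conv_all_nth near_def)
  have path: "(x, y) \<in> parcs (path_graph n) \<longleftrightarrow> x \<noteq> y \<and> x < n \<and> y < n \<and> near x y" for x y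
    by (auto simp: path_graph_def near_def)
  have verts: "xs \<in> pverts (grid (n # ns)) \<longleftrightarrow>
      (\<exists>x xs'. xs = x # xs' \<and> x < n \<and> xs' \<in> pverts (grid ns))" for xs
    unfolding pverts_grid by (simp add: list_all2_Cons2)
  have pn: "pverts (path_graph n) = {..<n}"
    by (simp add: path_graph_def)
  have near_refl: "near x x" for x by (simp add: near_def)
  show ?case
    unfolding verts
    unfolding list.map parcs_strong_product_list_Cons
    by (auto simp: strong_product_def Cons.IH path pn refl near_refl)
qed

lemma token_step_grid:
  assumes "xs \<in> pverts (grid ns)"
  shows "token_step (grid ns) xs ys \<longleftrightarrow> ys \<in> pverts (grid ns) \<and> list_all2 near xs ys"
proof -
  have "list_all2 near xs xs"
    by (simp add: list_all2_conv_all_nth near_def)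
  with assms show ?thesis
    by (auto simp: token_step_def parcs_grid)
qed

lemma president_play_grid:
  assumes "president_play (grid ns) p"
  shows "p t \<in> pverts (grid ns)" "list_all2 near (p t) (p (Suc t))"
proof -
  show *: "p t \<in> pverts (grid ns)" for t
    using assms by (induction t) (auto simp: president_play_def dest: token_step_grid[THEN iffD1])
  show "list_all2 near (p t) (p (Suc t))"
    using assms token_step_grid[OF *] unfolding president_play_def by blast
qed

text \<open>
  Offsets \<open>{-1, 0, 1}\<close> are shifted to \<open>{0, 1, 2}\<close>, so the null offset is \<open>replicate k 1\<close>.
\<close>

definition offsets :: "nat \<Rightarrow> nat list set" where
  "offsets k = {ds. set ds \<subseteq> {..<3} \<and> length ds = k} - {replicate k 1}"

lemma finite_offsets: "finite (offsets k)"
  unfolding offsets_def by (simp add: finite_lists_length_eq)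

lemma card_offsets: "card (offsets k) = 3 ^ k - 1"
proof -
  have "replicate k 1 \<in> {ds. set ds \<subseteq> {..<3::nat} \<and> length ds = k}"
    by auto
  then show ?thesis
    unfolding offsets_def by (simp add: card_Diff_singleton card_lists_length_eq)
qed

text \<open>
  On \<open>nat\<close>, \<open>x + d - 1\<close> is already clamped at \<open>0\<close>. For the empty history \<open>last\<close> is unspecified,
  but its value is cut off by the minimum with the length \<open>0\<close>.
\<close>

definition guard :: "nat list \<Rightarrow> nat list \<Rightarrow> nat list list \<Rightarrow> nat list" where
  "guard ns ds h =
     map (\<lambda>i. min (length h) (min (ns ! i - 1) (last h ! i + ds ! i - 1))) [0..<length ns]"

lemma guard_in_grid:
  assumes "0 \<notin> set ns"
  shows "guard ns ds h \<in> pverts (grid ns)"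
proof -
  have "0 < ns ! i" if "i < length ns" for i
    using assms that by (metis gr0I nth_mem)
  then show ?thesis
    by (auto simp: pverts_grid guard_def list_all2_conv_all_nth min_less_iff_disj)
qed

text \<open>Truncated translation keeps distances at most one, and so does a minimum of two
  quantities that each change by at most one. The growing cap \<open>t\<close> is such a
  quantity.\<close>

lemma near_clamp:
  "near x y \<Longrightarrow> near (min t (min a (x + d - 1))) (min (Suc t) (min a (y + d - 1)))"
  unfolding near_def by linarith

lemma guard_step:
  assumes "0 \<notin> set ns" "president_play (grid ns) p"
  shows "token_step (grid ns) (guard ns ds (map p [0..<t])) (guard ns ds (map p [0..<Suc t]))"
proof -
  have "list_all2 near (guard ns ds (map p [0..<t])) (guard ns ds (map p [0..<Suc t]))"
  proof (cases t)
    \<comment> \<open>The cap rises from 0 to 1 here, so the coordinates are 0 before and at most 1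
      after, wherever the president starts.\<close>
    case 0
    then show ?thesis
      by (simp add: guard_def list_all2_conv_all_nth near_def)
  next
    case (Suc s)
    have "length (p s) = length ns"
      using president_play_grid(1)[OF assms(2), of s] by (simp add: pverts_grid list_all2_lengthD)
    then have "near (p s ! i) (p t ! i)" if "i < length ns" for i
      using president_play_grid(2)[OF assms(2), of s] that Suc
      by (simp add: list_all2_conv_all_nth)
    then show ?thesis
      using Suc by (simp add: guard_def list_all2_conv_all_nth near_clamp[unfolded One_nat_def])
  qed
  then show ?thesis
    using assms(1) by (simp add: token_step_grid guard_in_grid)
qed

lemma guard_covers_neighbour:
  assumes arc: "(p t, w) \<in> parcs (grid ns)" and t: "sum_list ns \<le> t"
  shows "\<exists>ds \<in> offsets (length ns). guard ns ds (map p [0..<Suc t]) = w"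
proof -
  \<comment> \<open>The shifted difference of \<open>w\<close> and \<open>p t\<close>. Since
    \<open>p t ! i\<close> is at most \<open>w ! i + 1\<close>, the subtraction on
    \<open>nat\<close> is exact.\<close>
  define ds where "ds = map (\<lambda>i. w ! i + 1 - p t ! i) [0..<length ns]"
  have v: "length (p t) = length ns" and w: "length w = length ns"
    and w_less: "\<And>i. i < length ns \<Longrightarrow> w ! i < ns ! i"
    and near: "\<And>i. i < length ns \<Longrightarrow> near (p t ! i) (w ! i)" and ne: "p t \<noteq> w"
    using arc by (auto simp: parcs_grid pverts_grid list_all2_conv_all_nth)
  have "ds \<noteq> replicate (length ns) 1"
  proof
    assume *: "ds = replicate (length ns) 1"
    have "p t ! i = w ! i" if "i < length ns" for i
    proof -
      have "ds ! i = 1" using * that by simp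
      then show ?thesis using that by (simp add: ds_def)
    qed
    then have "p t = w" using v w by (simp add: nth_equalityI)
    with ne show False ..
  qed
  moreover have "w ! i + 1 - p t ! i < 3" if "i < length ns" for i
    using near[OF that] unfolding near_def by linarith
  then have "set ds \<subseteq> {..<3}"
    by (auto simp: ds_def)
  ultimately have "ds \<in> offsets (length ns)"
    by (simp add: offsets_def ds_def)
  moreover have "guard ns ds (map p [0..<Suc t]) = w"
  proof (rule nth_equalityI)
    fix i assume "i < length (guard ns ds (map p [0..<Suc t]))"
    then have i: "i < length ns" by (simp add: guard_def)
    \<comment> \<open>Hence the cap \<open>Suc t\<close> exceeds \<open>w ! i\<close>, as
      \<open>w ! i < ns ! i\<close>; the bound \<open>ns ! i - 1\<close> does not cut
      \<open>w ! i\<close> either.\<close>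
    have "ns ! i \<le> t"
      using i t elem_le_sum_list[of i ns] by simp
    then show "guard ns ds (map p [0..<Suc t]) ! i = w ! i"
      using i w_less[OF i] near[OF i] by (simp add: guard_def ds_def near_def)
  qed (simp add: guard_def w)
  ultimately show ?thesis ..
qed

lemma bodyguards_win_grid:
  assumes "0 \<notin> set ns"
  shows "bodyguards_win (grid ns) (3 ^ length ns - 1)"
proof -
  let ?m = "3 ^ length ns - 1 :: nat"
  obtain c where "bij_betw c {0..<?m} (offsets (length ns))"
    using ex_bij_betw_nat_finite[OF finite_offsets] card_offsets by metis
  then have c: "c ` {0..<?m} = offsets (length ns)"
    by (simp add: bij_betw_def)
  define S where "S = (\<lambda>h j. guard ns (c j) h)"
  have "bodyguard_strategy (grid ns) ?m S"
    by (simp add: bodyguard_strategy_def S_def assms guard_step guard_in_grid del: upt_Suc)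
  moreover have "surrounded (grid ns) ?m (S (map p [0..<Suc t])) (p t)"
    if "sum_list ns \<le> t" for p t
    unfolding surrounded_def
  proof (intro allI impI)
    fix w assume "(p t, w) \<in> parcs (grid ns)"
    from guard_covers_neighbour[where p = p, OF this that]
    obtain ds where "ds \<in> c ` {0..<?m}" "guard ns ds (map p [0..<Suc t]) = w"
      unfolding c by (elim bexE)
    then show "\<exists>j<?m. S (map p [0..<Suc t]) j = w"
      unfolding S_def by auto
  qed
  ultimately show ?thesis
    unfolding bodyguards_win_def by blast
qed

lemma bodyguards_win_grid_lower_bound:
  assumes "\<And>n. n \<in> set ns \<Longrightarrow> 3 \<le> n" and win: "bodyguards_win (grid ns) m"
  shows "3 ^ length ns - 1 \<le> m"
proof -
  define v where "v = replicate (length ns) (1::nat)"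
  have ns: "3 \<le> ns ! i" if "i < length ns" for i
    using assms(1) that by simp
  have v_in: "v \<in> pverts (grid ns)"
    using less_le_trans[OF _ ns] by (simp add: v_def pverts_grid list_all2_conv_all_nth)
  \<comment> \<open>Around the all-ones vertex, moving by a shifted offset \<open>w\<close> leads to
    \<open>w\<close> itself, so offsets can be read as neighbours. Coordinate 2 exists because every
    path has at least 3 vertices.\<close>
  have arcs: "(v, w) \<in> parcs (grid ns)" if "w \<in> offsets (length ns)" for w
  proof -
    have w: "length w = length ns" "w \<noteq> v" "set w \<subseteq> {..<3}"
      using that by (auto simp: offsets_def v_def)
    then have less: "w ! i < 3" if "i < length ns" for i
      using that by (metis lessThan_iff nth_mem subsetD)
    have "w \<in> pverts (grid ns)"
      using w less_le_trans[OF less ns] by (simp add: pverts_grid list_all2_conv_all_nth)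
    moreover have "near 1 (w ! i)" if "i < length ns" for i
      using less[OF that] by (simp add: near_def)
    then have "list_all2 near v w"
      using w by (simp add: v_def list_all2_conv_all_nth)
    ultimately show ?thesis
      using w v_in by (simp add: parcs_grid)
  qed
  have "president_play (grid ns) (\<lambda>_. v)"
    using v_in by (simp add: president_play_def token_step_def)
  \<comment> \<open>Any single late turn against the resting president supplies
    \<open>c\<close>.\<close>
  then obtain c where "surrounded (grid ns) m c v"
    using win unfolding bodyguards_win_def by blast
  then have "offsets (length ns) \<subseteq> c ` {..<m}"
    using arcs by (auto simp: surrounded_def image_iff)
  then have "card (offsets (length ns)) \<le> m"
    using surj_card_le[of "{..<m}"] by simp
  then show ?thesis
    by (simp add: card_offsets)
qed

theorem theorem5p3:
  fixes k :: nat and n :: "nat \<Rightarrow> nat"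
  assumes "k > 0"
    and "\<And>i. 1 \<le> i \<Longrightarrow> i \<le> k \<Longrightarrow> n i \<ge> 3"
  shows "bodyguard_number (strong_product_list (map (\<lambda>i. path_graph (n i)) [1..<Suc k])) = 3 ^ k - 1"
proof -
  define ns where "ns = map n [1..<Suc k]"
  have ge: "3 \<le> m" if "m \<in> set ns" for m
    using that assms(2) by (auto simp: ns_def)
  then have "0 \<notin> set ns" by force
  moreover have "length ns = k" by (simp add: ns_def)
  ultimately have "bodyguard_number (grid ns) = 3 ^ k - 1"
    unfolding bodyguard_number_def
    using bodyguards_win_grid bodyguards_win_grid_lower_bound[OF ge]
    by (intro Least_equality) auto
  then show ?thesis
    by (simp add: ns_def comp_def del: upt_Suc)
qed

end
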